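(* Define functions $Q_m$ ($m\ge 1$) of a real variable $d$ recursively by \[ Q_1(d)=\frac{1-4d}{8},\qquad Q_{2m}(d)=\int_0^d 2Q_{2m-1}(x)\,dx,\qquad Q_{2m+1}(d)=\int_d^{1/4}2Q_{2m}(x)\,dx\qquad (m\ge 1). \] Then each $Q_m$ is a polynomial of degree at most $m$ with rational coefficients, and for every integer $k\ge 1$, \[ \zeta(2k)=\frac{(2\pi)^{2k}\,Q_{2k-1}(0)}{2^{2k}-1}. \]
   Context: Here $\zeta(2k)=\sum_{n=1}^{\infty}\frac{1}{n^{2k}}$ is the Riemann zeta function at $2k$. *)

theory Defs
  imports "HOL-Analysis.Analysis" "HOL-Computational_Algebra.Polynomial"
begin

text \<open>
  The family is indexed from 1; \<open>Q 0\<close> is a dummy value that the recursion never uses.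
  The interval integral is oriented, so \<open>Q m d\<close> has its usual meaning for every real \<open>d\<close>,
  including \<open>d < 0\<close> and \<open>d > 1/4\<close>.
\<close>

fun Q :: "nat \<Rightarrow> real \<Rightarrow> real" where
  "Q 0 d = 0"
| "Q (Suc 0) d = (1 - 4 * d) / 8"
| "Q (Suc (Suc n)) d =
     (if even n
      then LBINT x=ereal 0..ereal d. 2 * Q (Suc n) x
      else LBINT x=ereal d..ereal (1/4). 2 * Q (Suc n) x)"

lemma Q_1: "Q 1 d = (1 - 4 * d) / 8"
  by simp

lemma Q_even:
  assumes "m \<ge> 1"
  shows "Q (2 * m) d = (LBINT x=ereal 0..ereal d. 2 * Q (2 * m - 1) x)"
proof -
  obtain j where "m = Suc j" using assms by (cases m) auto
  then show ?thesis by simp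
qed

lemma Q_odd:
  assumes "m \<ge> 1"
  shows "Q (2 * m + 1) d = (LBINT x=ereal d..ereal (1/4). 2 * Q (2 * m) x)"
proof -
  obtain j where "m = Suc j" using assms by (cases m) auto
  then show ?thesis by (simp del: Q.simps add: Q.simps(3)[of "Suc (2 * j)"])
qed

text \<open>Meaningful for \<open>s \<ge> 2\<close>, where the series converges; the summation index is shifted by one.\<close>

definition zeta :: "nat \<Rightarrow> real" where
  "zeta s = (\<Sum>n. 1 / real (Suc n) ^ s)"

lemma zeta_sums:
  assumes "s \<ge> 2"
  shows "(\<lambda>n. 1 / real (Suc n) ^ s) sums zeta s"
proof -
  have "summable (\<lambda>n. inverse (real n ^ s))"
    using inverse_power_summable[OF assms, where 'a = real] by simp
  then have "summable (\<lambda>n. 1 / real (Suc n) ^ s)"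
    by (subst (asm) summable_Suc_iff[symmetric]) (simp add: divide_inverse)
  then show ?thesis unfolding zeta_def by (rule summable_sums)
qed

end

theory Submission
  imports Defs
begin

text \<open>
  The functions \<open>Q m\<close> are the classical sums of odd-frequency Fourier series on \<open>[0, 1/4]\<close>:
  with \<open>N\<close> ranging over the odd positive integers,
  \<open>Q m d = (\<Sum>N. T (2 \<pi> N d) / (\<pi> N) ^ (m + 1))\<close>, where \<open>T\<close> is cosine for odd \<open>m\<close> and sine for
  even \<open>m\<close>.  At \<open>d = 0\<close> and \<open>m = 2 k - 1\<close> every cosine equals 1, so
  \<open>\<pi> ^ (2 k) * Q (2 k - 1) 0\<close> is the sum of \<open>1 / N ^ (2 k)\<close> over odd \<open>N\<close>, which is
  \<open>(1 - 2 ^ - (2 k)) \<zeta>(2 k)\<close>.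

  To avoid differentiating or integrating infinite series, the Fourier claim is proved for partial
  sums \<open>P m n\<close>: they converge to \<open>Q m\<close> uniformly on \<open>[0, 1/4]\<close>.  The defining recursion says that
  \<open>Q (m + 1)\<close> has derivative \<open>\<plusminus>2 Q m\<close> and vanishes at \<open>0\<close> or at \<open>1/4\<close>.  The partial sums obey
  exactly the same rules, so by the mean value theorem the error of step \<open>m + 1\<close> is at most half
  of the error of step \<open>m\<close> (\<open>uniform_limit_step\<close>).

  This leaves the case \<open>m = 1\<close>, the triangle wave.  Its termwise derivative is the square wave
  \<open>P 0 n\<close>, whose own derivative is the Dirichlet-type kernel \<open>sin (4 \<pi> n x) / sin (2 \<pi> x)\<close>.
  The oscillation of the numerator makes \<open>P 0 n\<close> constant up to \<open>O(1/n)\<close> away from the jump at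
  \<open>0\<close>, and Leibniz's series for \<open>\<pi>/4\<close> gives the constant.  Hence \<open>P 1 n\<close> has the right limit on
  \<open>(0, 1/4]\<close>; the series \<open>P 1\<close> converges uniformly, so its sum is continuous and the limit is
  right at \<open>0\<close> as well.
\<close>

section \<open>The recursion in differential form, and polynomiality\<close>

lemma Q_Suc_antiderivative:
  assumes "m \<ge> 1" and F: "\<And>x. (F has_field_derivative 2 * Q m x) (at x)"
    and cont: "continuous_on UNIV (Q m)"
  shows "Q (Suc m) d = (if odd m then F d - F 0 else F (1/4) - F d)"
proof -
  obtain n where m: "m = Suc n" using assms(1) by (cases m) auto
  have FTC: "(LBINT x=ereal a..ereal b. 2 * Q m x) = F b - F a" for a b
  proof (rule interval_integral_FTC_finite)
    show "continuous_on {min a b..max a b} (\<lambda>x. 2 * Q m x)"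
      by (intro continuous_intros continuous_on_subset[OF cont]) auto
    show "(F has_vector_derivative 2 * Q m x) (at x within {min a b..max a b})" for x
      using F[of x] has_field_derivative_at_within
        has_real_derivative_iff_has_vector_derivative by blast
  qed
  show ?thesis using FTC m by simp
qed

lemma rational_poly_antiderivative:
  fixes p :: "real poly"
  assumes rat: "\<forall>i. coeff p i \<in> \<rat>"
  obtains q where "pderiv q = p" "degree q \<le> Suc (degree p)" "\<forall>i. coeff q i \<in> \<rat>"
proof -
  define q where "q = (\<Sum>i\<le>degree p. monom (coeff p i / real (Suc i)) (Suc i))"
  have "pderiv q = (\<Sum>i\<le>degree p. monom (coeff p i) i)"
    unfolding q_def by (simp add: higher_pderiv_sum[of 1, simplified] pderiv_monom del: of_nat_Suc)
  then have "pderiv q = p" by (simp add: poly_as_sum_of_monoms)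
  moreover have "degree q \<le> Suc (degree p)"
    unfolding q_def by (intro degree_sum_le) (auto intro: order_trans[OF degree_monom_le])
  moreover have "coeff q i \<in> \<rat>" for i
    unfolding q_def coeff_sum using rat by (intro Rats_sum) auto
  ultimately show thesis using that by blast
qed

lemma poly_rational:
  fixes p :: "real poly"
  assumes "\<forall>i. coeff p i \<in> \<rat>" "x \<in> \<rat>"
  shows "poly p x \<in> \<rat>"
  unfolding poly_altdef using assms by (intro Rats_sum Rats_mult) auto

text \<open>
  Rational coefficients survive a recursion step because the limits \<open>0\<close> and \<open>1/4\<close> of
  integration are rational.
\<close>

lemma Q_rational_poly:
  assumes "m \<ge> 1"
  shows "\<exists>p :: real poly. degree p \<le> m \<and> (\<forall>i. coeff p i \<in> \<rat>) \<and> (\<forall>d. Q m d = poly p d)"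
  using assms
proof (induction m rule: dec_induct)
  case base
  have "coeff [:1/8, -1/2 :: real:] i \<in> \<rat>" for i
    by (auto simp: coeff_pCons split: nat.split)
  moreover have "Q 1 d = poly [:1/8, -1/2:] d" for d by (simp add: field_simps)
  ultimately show ?case by (intro exI[of _ "[:1/8, -1/2:]"]) auto
next
  case (step m)
  then obtain p :: "real poly" where p: "degree p \<le> m" "\<forall>i. coeff p i \<in> \<rat>" "\<And>d. Q m d = poly p d"
    by blast
  obtain q where q: "pderiv q = p" "degree q \<le> Suc (degree p)" "\<forall>i. coeff q i \<in> \<rat>"
    using rational_poly_antiderivative p(2) by blast
  have qQ: "Q (Suc m) d = (if odd m then 2 * poly q d - 2 * poly q 0
                               else 2 * poly q (1/4) - 2 * poly q d)" for d
  proof (rule Q_Suc_antiderivative[where F = "\<lambda>x. 2 * poly q x"])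
    show "((\<lambda>x. 2 * poly q x) has_field_derivative 2 * Q m x) (at x)" for x
      using DERIV_cmult[OF poly_DERIV[of q x], of 2] q(1) p(3) by simp
    show "continuous_on UNIV (Q m)"
      using p(3) by (simp add: continuous_on_poly ext[of "Q m" "poly p"])
  qed (use step in auto)
  define r where "r = (if odd m then smult 2 q - [:2 * poly q 0:] else [:2 * poly q (1/4):] - smult 2 q)"
  have rat: "poly q 0 \<in> \<rat>" "poly q (1/4) \<in> \<rat>"
    using q(3) by (auto intro!: poly_rational)
  have "degree r \<le> Suc m"
    unfolding r_def using p(1) q(2) by (auto intro!: degree_diff_le order_trans[OF degree_smult_le])
  moreover have "coeff r i \<in> \<rat>" for i
    unfolding r_def using rat q(3) by (auto simp: coeff_pCons split: nat.split)
  moreover have "Q (Suc m) d = poly r d" for d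
    by (simp add: qQ r_def)
  ultimately show ?case by blast
qed

lemma
  assumes "m \<ge> 1"
  shows Q_Suc_has_derivative:
      "(Q (Suc m) has_field_derivative (if odd m then 2 else -2) * Q m x) (at x)"
    and Q_Suc_zero: "Q (Suc m) (if odd m then 0 else 1/4) = 0"
proof -
  obtain p :: "real poly" where p: "\<forall>i. coeff p i \<in> \<rat>" "Q m = poly p"
    using Q_rational_poly[OF assms] by blast
  obtain q where q: "pderiv q = p"
    using rational_poly_antiderivative p(1) by blast
  have deriv: "((\<lambda>x. 2 * poly q x) has_field_derivative 2 * Q m x) (at x)" for x
    using DERIV_cmult[OF poly_DERIV[of q x], of 2] q p(2) by simp
  have eq: "Q (Suc m) d = (if odd m then 2 * poly q d - 2 * poly q 0
                               else 2 * poly q (1/4) - 2 * poly q d)" for d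
    by (rule Q_Suc_antiderivative[OF assms deriv]) (auto simp: p(2) intro: continuous_intros)
  show "Q (Suc m) (if odd m then 0 else 1/4) = 0" by (simp add: eq)
  show "(Q (Suc m) has_field_derivative (if odd m then 2 else -2) * Q m x) (at x)"
    unfolding ext[of "Q (Suc m)", OF eq]
    using deriv[of x] by (auto intro!: derivative_eq_intros simp: p(2) q)
qed

section \<open>Partial sums of the Fourier series\<close>

text \<open>
  The index \<open>m = 0\<close> is meaningful here: \<open>P 0 n\<close> approximates the square wave, which equals \<open>1/4\<close>
  on \<open>(0, 1/4]\<close> and whose integral from \<open>d\<close> to \<open>1/4\<close>, doubled, is \<open>Q 1 d\<close>.
\<close>

definition P :: "nat \<Rightarrow> nat \<Rightarrow> real \<Rightarrow> real" where
  "P m n d = (\<Sum>j<n. (if odd m then cos (2 * pi * real (2 * j + 1) * d)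
                               else sin (2 * pi * real (2 * j + 1) * d))
                     / (pi * real (2 * j + 1)) ^ (m + 1))"

lemma P_Suc_has_derivative:
  "(P (Suc m) n has_field_derivative (if odd m then 2 else -2) * P m n x) (at x)"
proof (cases "odd m")
  case True
  have "((\<lambda>d. sin (2 * pi * real (2 * j + 1) * d) / (pi * real (2 * j + 1)) ^ (m + 2))
          has_field_derivative 2 * (cos (2 * pi * real (2 * j + 1) * x) / (pi * real (2 * j + 1)) ^ (m + 1))) (at x)" for j
    by (rule derivative_eq_intros refl | simp add: field_simps del: of_nat_add of_nat_Suc)+
  then show ?thesis using True
    unfolding P_def[abs_def] by (auto simp: sum_distrib_left intro!: DERIV_sum)
next
  case False
  have "((\<lambda>d. cos (2 * pi * real (2 * j + 1) * d) / (pi * real (2 * j + 1)) ^ (m + 2))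
          has_field_derivative -2 * (sin (2 * pi * real (2 * j + 1) * x) / (pi * real (2 * j + 1)) ^ (m + 1))) (at x)" for j
    by (rule derivative_eq_intros refl | simp add: field_simps del: of_nat_add of_nat_Suc)+
  then have "((\<lambda>d. \<Sum>j<n. cos (2 * pi * real (2 * j + 1) * d) / (pi * real (2 * j + 1)) ^ (m + 2))
          has_field_derivative (\<Sum>j<n. -2 * (sin (2 * pi * real (2 * j + 1) * x) / (pi * real (2 * j + 1)) ^ (m + 1)))) (at x)"
    by (intro DERIV_sum)
  then show ?thesis using False
    unfolding P_def[abs_def] by (simp add: sum_distrib_left)
qed

text \<open>
  At \<open>1/4\<close> the cosines vanish because \<open>j\<close> enters only through the odd number \<open>2 j + 1\<close>; this is
  why the even frequencies are absent from the series.
\<close>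

lemma cos_odd_half_pi: "cos (2 * pi * real (2 * j + 1) * (1/4)) = 0"
proof -
  have "2 * pi * real (2 * j + 1) * (1/4) = real j * pi + pi / 2" by (simp add: field_simps)
  then show ?thesis by (simp only: cos_add) simp
qed

lemma sin_odd_half_pi: "sin (2 * pi * real (2 * j + 1) * (1/4)) = (-1) ^ j"
proof -
  have "2 * pi * real (2 * j + 1) * (1/4) = real j * pi + pi / 2" by (simp add: field_simps)
  then show ?thesis by (simp only: sin_add) simp
qed

lemma P_Suc_zero: "P (Suc m) n (if odd m then 0 else 1/4) = 0"
  unfolding P_def using cos_odd_half_pi by auto

text \<open>
  The difference of \<open>P (m + 1)\<close> and \<open>Q (m + 1)\<close> vanishes at an end of the interval, which has
  length \<open>1/4\<close>, and its slope is at most twice the previous error.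
\<close>

lemma uniform_limit_step:
  assumes "m \<ge> 1" and lim: "uniform_limit {0..1/4} (P m) (Q m) sequentially"
  shows "uniform_limit {0..1/4} (P (Suc m)) (Q (Suc m)) sequentially"
proof (rule uniform_limitI)
  fix e :: real assume "e > 0"
  have "\<forall>\<^sub>F n in sequentially. \<forall>x\<in>{0..1/4}. dist (P m n x) (Q m x) < e"
    using uniform_limitD[OF lim \<open>e > 0\<close>] .
  then show "\<forall>\<^sub>F n in sequentially. \<forall>x\<in>{0..1/4}. dist (P (Suc m) n x) (Q (Suc m) x) < e"
  proof eventually_elim
    case (elim n)
    define s :: real where "s = (if odd m then 2 else -2)"
    define z :: real where "z = (if odd m then 0 else 1/4)"
    have z: "z \<in> {0..1/4}" "P (Suc m) n z = 0" "Q (Suc m) z = 0"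
      using P_Suc_zero[of m n] Q_Suc_zero[OF assms(1)] by (auto simp: z_def)
    show ?case
    proof
      fix x :: real assume x: "x \<in> {0..1/4}"
      have "norm ((P (Suc m) n x - Q (Suc m) x) - (P (Suc m) n z - Q (Suc m) z)) \<le> (2 * e) * norm (x - z)"
      proof (rule field_differentiable_bound[OF convex_real_interval(5) _ _ x z(1)])
        fix y :: real assume y: "y \<in> {0..1/4}"
        show "((\<lambda>x. P (Suc m) n x - Q (Suc m) x) has_field_derivative s * P m n y - s * Q m y)
                (at y within {0..1/4})"
          unfolding s_def
          by (intro DERIV_diff has_field_derivative_at_within[OF P_Suc_has_derivative]
              has_field_derivative_at_within[OF Q_Suc_has_derivative] assms)
        have "\<bar>s\<bar> = 2" by (simp add: s_def)
        moreover have "\<bar>P m n y - Q m y\<bar> \<le> e"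
          using elim y by (force simp: dist_real_def)
        ultimately show "norm (s * P m n y - s * Q m y) \<le> 2 * e"
          unfolding right_diff_distrib[symmetric] by (simp add: abs_mult)
      qed
      also have "\<dots> \<le> (2 * e) * (1/4)"
        using x z(1) \<open>e > 0\<close> by (intro mult_left_mono) (auto simp: abs_if)
      also have "\<dots> < e" using \<open>e > 0\<close> by simp
      finally show "dist (P (Suc m) n x) (Q (Suc m) x) < e" by (simp add: z dist_real_def)
    qed
  qed
qed

section \<open>The triangle wave\<close>

lemma sum_cos_odd_multiples:
  "sin x * (\<Sum>j<n. 2 * cos (real (2 * j + 1) * x)) = sin (2 * real n * x)"
proof (induction n)
  case (Suc n)
  have "sin x * (2 * cos (real (2 * n + 1) * x)) = sin (2 * real (Suc n) * x) - sin (2 * real n * x)"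
    using sin_times_cos[of x "real (2 * n + 1) * x"] sin_minus[of "2 * real n * x"]
    by (simp add: algebra_simps)
  then show ?case using Suc by (simp add: distrib_left)
qed simp

lemma P_0_has_derivative:
  assumes "sin (2 * pi * x) \<noteq> 0"
  shows "(P 0 n has_field_derivative sin (4 * pi * real n * x) / sin (2 * pi * x)) (at x)"
proof -
  have "((\<lambda>d. sin (2 * pi * real (2 * j + 1) * d) / (pi * real (2 * j + 1)))
          has_field_derivative 2 * cos (real (2 * j + 1) * (2 * pi * x))) (at x)" for j
    by (rule derivative_eq_intros refl | simp add: field_simps del: of_nat_add of_nat_Suc)+
  then have "(P 0 n has_field_derivative (\<Sum>j<n. 2 * cos (real (2 * j + 1) * (2 * pi * x)))) (at x)"
    unfolding P_def[abs_def] by (auto intro!: DERIV_sum)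
  moreover have "(\<Sum>j<n. 2 * cos (real (2 * j + 1) * (2 * pi * x))) = sin (4 * pi * real n * x) / sin (2 * pi * x)"
    using sum_cos_odd_multiples[of "2 * pi * x" n] assms by (simp add: field_simps)
  ultimately show ?thesis by simp
qed

text \<open>
  Adding \<open>cos (4 \<pi> n x) / (4 \<pi> n sin (2 \<pi> x))\<close> to the square wave cancels the oscillating kernel
  in its derivative and leaves one of size \<open>O(1/n)\<close>.  This is integration by parts, as in the
  Riemann-Lebesgue lemma, carried out on antiderivatives.
\<close>

lemma P_0_almost_constant:
  assumes d: "0 < d" "d \<le> x" "x \<le> 1/4" and n: "n > 0"
  shows "\<bar>P 0 n x - P 0 n (1/4)\<bar> \<le> 1 / (real n * (sin (2 * pi * d))\<^sup>2)"
proof -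
  define s where "s = sin (2 * pi * d)"
  define w where "w = (\<lambda>y. cos (4 * pi * real n * y) / (4 * pi * real n * sin (2 * pi * y)))"
  have s0: "s > 0" unfolding s_def using d by (intro sin_gt_zero) auto
  have sin_ge: "s \<le> sin (2 * pi * y)" if "y \<in> {d..1/4}" for y
    proof -
    have "0 \<le> 2 * pi * d" using d by simp
    then have "- (pi / 2) \<le> 2 * pi * d" using pi_gt_zero by linarith
    then show ?thesis unfolding s_def using that by (intro sin_monotone_2pi_le) auto
  qed
  have s1: "s \<le> 1" unfolding s_def by simp
  have ns: "real n * s\<^sup>2 > 0" using n s0 by simp
  have w_le: "\<bar>w y\<bar> \<le> 1 / (4 * (real n * s\<^sup>2))" if y: "y \<in> {d..1/4}" for y
  proof -
    have "s\<^sup>2 \<le> 1 * sin (2 * pi * y)"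
      unfolding power2_eq_square using s0 s1 sin_ge[OF y] by (intro mult_mono) auto
    moreover have "1 \<le> pi" using pi_ge_two by simp
    ultimately have "1 * (real n * s\<^sup>2) \<le> pi * (real n * sin (2 * pi * y))"
      using n s0 by (intro mult_mono) auto
    then have "4 * (real n * s\<^sup>2) \<le> 4 * pi * real n * sin (2 * pi * y)" by simp
    moreover have "sin (2 * pi * y) > 0" using sin_ge[OF y] s0 by simp
    ultimately show ?thesis
      unfolding w_def abs_divide using ns by (intro frac_le) (auto simp: abs_mult)
  qed
  have "norm ((P 0 n x + w x) - (P 0 n (1/4) + w (1/4))) \<le> (1 / (2 * (real n * s\<^sup>2))) * norm (x - 1/4)"
  proof (rule field_differentiable_bound[where S = "{d..1/4}"])
    fix y assume y: "y \<in> {d..1/4}"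
    have sy: "sin (2 * pi * y) > 0" using sin_ge[OF y] s0 by simp
    define D where "D = - cos (4 * pi * real n * y) * cos (2 * pi * y) / (2 * (real n * (sin (2 * pi * y))\<^sup>2))"
    have "(w has_field_derivative - sin (4 * pi * real n * y) / sin (2 * pi * y) + D) (at y)"
      unfolding w_def D_def using sy n
      by (auto intro!: derivative_eq_intros simp: field_simps power2_eq_square)
    from DERIV_add[OF P_0_has_derivative[of y n] this]
    show "((\<lambda>y. P 0 n y + w y) has_field_derivative D) (at y within {d..1/4})"
      using sy by (auto intro: has_field_derivative_at_within)
    have "\<bar>cos (4 * pi * real n * y) * cos (2 * pi * y)\<bar> \<le> 1 * 1"
      unfolding abs_mult by (intro mult_mono) auto
    moreover have "s\<^sup>2 \<le> (sin (2 * pi * y))\<^sup>2" using s0 sin_ge[OF y] by (intro power_mono) auto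
    ultimately show "norm D \<le> 1 / (2 * (real n * s\<^sup>2))"
      unfolding D_def real_norm_def abs_divide using ns n by (intro frac_le) (auto simp: abs_mult)
  qed (use d in auto)
  also have "\<dots> \<le> (1 / (2 * (real n * s\<^sup>2))) * (1/4)"
    using d ns by (intro mult_left_mono) (auto simp: abs_if)
  finally have "\<bar>P 0 n x - P 0 n (1/4)\<bar> \<le> (1 / (2 * (real n * s\<^sup>2))) * (1/4) + \<bar>w x\<bar> + \<bar>w (1/4)\<bar>"
    unfolding real_norm_def by linarith
  also have "\<dots> \<le> (1 / (2 * (real n * s\<^sup>2))) * (1/4) + 1 / (4 * (real n * s\<^sup>2)) + 1 / (4 * (real n * s\<^sup>2))"
    using w_le d by (intro add_mono) auto
  also have "\<dots> \<le> 1 / (real n * s\<^sup>2)" using ns by (simp add: field_simps)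
  finally show ?thesis unfolding s_def .
qed

lemma P_0_quarter_tendsto: "(\<lambda>n. P 0 n (1/4)) \<longlonglongrightarrow> 1/4"
proof -
  have "(\<lambda>k. (-1) ^ k * (1 / real (k * 2 + 1) * 1 ^ (k * 2 + 1))) sums (pi / 4)"
    using summable_sums[OF summable_arctan_series[of 1]] by (simp add: pi_series)
  from sums_divide[OF this, of pi]
  have "(\<lambda>k. (-1) ^ k / (pi * real (2 * k + 1))) sums (1/4)"
    by (simp add: mult.commute)
  moreover have "P 0 n (1/4) = (\<Sum>k<n. (-1) ^ k / (pi * real (2 * k + 1)))" for n
    unfolding P_def using sin_odd_half_pi by simp
  ultimately show ?thesis by (simp add: sums_def)
qed

text \<open>
  Replacing the slope \<open>-2 P 0 n\<close> of \<open>P 1 n\<close> by its almost constant value gives a straight line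
  through the common zero \<open>1/4\<close>.
\<close>

lemma P_1_tendsto_pos:
  assumes d: "0 < d" "d \<le> 1/4"
  shows "(\<lambda>n. P 1 n d) \<longlonglongrightarrow> Q 1 d"
proof -
  define s where "s = sin (2 * pi * d)"
  define L where "L = (\<lambda>n. 2 * P 0 n (1/4) * (1/4 - d))"
  have close: "\<bar>P 1 n d - L n\<bar> \<le> (1 / (2 * s\<^sup>2)) / real n" if n: "n > 0" for n
  proof -
    have "norm ((P 1 n d - 2 * P 0 n (1/4) * (1/4 - d)) - (P 1 n (1/4) - 2 * P 0 n (1/4) * (1/4 - 1/4)))
          \<le> (2 / (real n * s\<^sup>2)) * norm (d - 1/4)"
    proof (rule field_differentiable_bound[where S = "{d..1/4}"])
      fix y assume y: "y \<in> {d..1/4}"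
      have "((\<lambda>y. P 1 n y - 2 * P 0 n (1/4) * (1/4 - y)) has_field_derivative
               - 2 * (P 0 n y - P 0 n (1/4))) (at y)"
        using P_Suc_has_derivative[of 0 n y] by (auto intro!: derivative_eq_intros)
      then show "((\<lambda>y. P 1 n y - 2 * P 0 n (1/4) * (1/4 - y)) has_field_derivative
               - 2 * (P 0 n y - P 0 n (1/4))) (at y within {d..1/4})"
        by (rule has_field_derivative_at_within)
      have "\<bar>P 0 n y - P 0 n (1/4)\<bar> \<le> 1 / (real n * s\<^sup>2)"
        unfolding s_def using d y n by (intro P_0_almost_constant) auto
      then show "norm (- 2 * (P 0 n y - P 0 n (1/4))) \<le> 2 / (real n * s\<^sup>2)"
        by (simp add: abs_mult)
    qed (use d in auto)
    also have "\<dots> \<le> (2 / (real n * s\<^sup>2)) * (1/4)"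
      using d by (intro mult_left_mono) (auto simp: abs_if)
    finally show ?thesis using P_Suc_zero[of 0 n] by (simp add: L_def mult.commute)
  qed
  have "(\<lambda>n. P 1 n d - L n) \<longlonglongrightarrow> 0"
  proof (rule Lim_null_comparison)
    show "\<forall>\<^sub>F n in sequentially. norm (P 1 n d - L n) \<le> (1 / (2 * s\<^sup>2)) / real n"
      using eventually_gt_at_top[of 0] by eventually_elim (use close in auto)
    show "(\<lambda>n. (1 / (2 * s\<^sup>2)) / real n) \<longlonglongrightarrow> 0" by (rule lim_const_over_n)
  qed
  moreover have "L \<longlonglongrightarrow> 2 * (1/4) * (1/4 - d)"
    unfolding L_def by (intro tendsto_intros P_0_quarter_tendsto)
  ultimately have "(\<lambda>n. (P 1 n d - L n) + L n) \<longlonglongrightarrow> 0 + 2 * (1/4) * (1/4 - d)"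
    by (rule tendsto_add)
  then show ?thesis by (simp add: field_simps)
qed

lemma uniform_limit_triangle_wave: "uniform_limit {0..1/4} (P 1) (Q 1) sequentially"
proof -
  define c where "c = (\<lambda>j x. cos (2 * pi * real (2 * j + 1) * x) / (pi * real (2 * j + 1))\<^sup>2)"
  define f where "f = (\<lambda>x. \<Sum>j. c j x)"
  have P1: "P 1 = (\<lambda>n x. \<Sum>j<n. c j x)"
    by (intro ext) (simp add: P_def c_def numeral_2_eq_2)
  have lim: "uniform_limit {0..1/4} (P 1) f sequentially"
    unfolding P1 f_def
  proof (rule Weierstrass_m_test)
    fix j :: nat and x :: real
    have "real (Suc j) \<le> pi * real (2 * j + 1)"
      using mult_mono[of 1 pi "real (Suc j)" "real (2 * j + 1)"] pi_ge_two by simp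
    then have "(real (Suc j))\<^sup>2 \<le> (pi * real (2 * j + 1))\<^sup>2" by (intro power_mono) auto
    then show "norm (c j x) \<le> 1 / (real (Suc j))\<^sup>2"
      unfolding c_def real_norm_def abs_divide by (intro frac_le) auto
    show "summable (\<lambda>j. 1 / (real (Suc j))\<^sup>2)"
      using sums_summable[OF zeta_sums[of 2]] by simp
  qed
  have "continuous_on {0..1/4} f"
  proof (rule uniform_limit_theorem[OF _ lim])
    have "continuous_on {0..1/4} (P 1 n)" for n
      unfolding P1 c_def by (intro continuous_intros) auto
    then show "\<forall>\<^sub>F n in sequentially. continuous_on {0..1/4} (P 1 n)" by simp
  qed simp
  moreover have "continuous_on {0..1/4} (Q 1)"
    by (auto intro!: continuous_intros simp: Q_1[abs_def])
  ultimately have cont: "continuous_on (closure {0<..1/4}) (\<lambda>x. f x - Q 1 x)"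
    by (simp add: continuous_on_diff)
  have pos: "f x - Q 1 x = 0" if "x \<in> {0<..1/4}" for x
    using LIMSEQ_unique[OF tendsto_uniform_limitI[OF lim, of x] P_1_tendsto_pos[of x]] that by auto
  have "f x = Q 1 x" if "x \<in> {0..1/4}" for x
    using continuous_constant_on_closure[OF cont pos, of x] that by simp
  then have "uniform_limit {0..1/4} (P 1) f sequentially \<longleftrightarrow> uniform_limit {0..1/4} (P 1) (Q 1) sequentially"
    by (intro uniform_limit_cong') auto
  then show ?thesis using lim by blast
qed

lemma uniform_limit_Fourier:
  assumes "m \<ge> 1"
  shows "uniform_limit {0..1/4} (P m) (Q m) sequentially"
  using assms
proof (induction m rule: dec_induct)
  case base
  show ?case by (rule uniform_limit_triangle_wave)
next
  case (step m)
  then show ?case by (intro uniform_limit_step)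
qed

section \<open>The zeta values\<close>

lemma sum_split_odd_even:
  fixes f :: "nat \<Rightarrow> real"
  shows "(\<Sum>i<2 * n. f i) = (\<Sum>j<n. f (2 * j)) + (\<Sum>j<n. f (2 * j + 1))"
  by (induction n) auto

lemma odd_zeta_sums:
  assumes s: "s \<ge> 2"
  shows "(\<lambda>j. 1 / real (2 * j + 1) ^ s) sums (zeta s - zeta s / 2 ^ s)"
proof -
  define f where "f = (\<lambda>i. 1 / real (Suc i) ^ s)"
  have z: "f sums zeta s" unfolding f_def by (rule zeta_sums[OF s])
  have "filterlim (\<lambda>n. 2 * n) at_top (sequentially :: nat filter)"
    by (intro filterlim_subseq strict_monoI) auto
  with z have A: "(\<lambda>n. \<Sum>i<2 * n. f i) \<longlonglongrightarrow> zeta s"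
    unfolding sums_def by (rule filterlim_compose)
  have "f (2 * j + 1) = f j / 2 ^ s" for j
  proof -
    have "real (Suc (2 * j + 1)) = 2 * real (Suc j)" by simp
    then show ?thesis unfolding f_def by (simp only: power_mult_distrib) simp
  qed
  then have B: "(\<lambda>j. f (2 * j + 1)) sums (zeta s / 2 ^ s)"
    using sums_divide[OF z] by simp
  have "(\<lambda>n. (\<Sum>i<2 * n. f i) - (\<Sum>j<n. f (2 * j + 1))) \<longlonglongrightarrow> zeta s - zeta s / 2 ^ s"
    using A B unfolding sums_def by (rule tendsto_diff)
  then show ?thesis by (simp add: sum_split_odd_even sums_def f_def)
qed

lemma zeta_even_eq_Q:
  assumes k: "k \<ge> 1"
  shows "zeta (2 * k) = (2 * pi) ^ (2 * k) * Q (2 * k - 1) 0 / (2 ^ (2 * k) - 1)"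
proof -
  have P: "P (2 * k - 1) n 0 = (\<Sum>j<n. 1 / real (2 * j + 1) ^ (2 * k)) / pi ^ (2 * k)" for n
    using k by (simp add: P_def power_mult_distrib sum_divide_distrib mult.commute del: of_nat_add of_nat_Suc)
  have "(\<lambda>n. P (2 * k - 1) n 0) \<longlonglongrightarrow> Q (2 * k - 1) 0"
    using k by (intro tendsto_uniform_limitI[OF uniform_limit_Fourier]) auto
  moreover have "(\<lambda>n. P (2 * k - 1) n 0) \<longlonglongrightarrow> (zeta (2 * k) - zeta (2 * k) / 2 ^ (2 * k)) / pi ^ (2 * k)"
    unfolding P using odd_zeta_sums[of "2 * k"] k by (intro tendsto_divide) (auto simp: sums_def)
  ultimately have "Q (2 * k - 1) 0 = (zeta (2 * k) - zeta (2 * k) / 2 ^ (2 * k)) / pi ^ (2 * k)"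
    by (rule LIMSEQ_unique)
  then have "(2 * pi) ^ (2 * k) * Q (2 * k - 1) 0 = zeta (2 * k) * (2 ^ (2 * k) - 1)"
    by (simp add: power_mult_distrib field_simps)
  moreover have "(2 :: real) ^ (2 * k) - 1 \<noteq> 0"
  proof -
    have "1 < (2 :: real) ^ (2 * k)" by (rule one_less_power) (use k in auto)
    then show ?thesis by linarith
  qed
  ultimately show ?thesis by (simp add: field_simps)
qed

theorem theorem8:
  shows "(\<forall>m\<ge>1. \<exists>p :: real poly. degree p \<le> m \<and> (\<forall>i. coeff p i \<in> \<rat>) \<and> (\<forall>d. Q m d = poly p d)) \<and>
         (\<forall>k\<ge>1. zeta (2 * k) = (2 * pi) ^ (2 * k) * Q (2 * k - 1) 0 / (2 ^ (2 * k) - 1))"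
  using Q_rational_poly zeta_even_eq_Q by blast

end
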